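(* Let $H=(V,E,c,\omega)$ be a weighted hypergraph, let $k\ge 2$ be an even integer, $\varepsilon\ge 0$, and set $L_k:=(1+\varepsilon)\lceil c(V)/k\rceil$ and $L_2:=(1+\varepsilon')\lceil c(V)/2\rceil$ with $\varepsilon':=\big((1+\varepsilon)\tfrac{c(V)}{k}\cdot\tfrac{k}{c(V)}\big)^{1/\lceil\log_2 k\rceil}-1$. Let $\Pi_P=\{P_1,P_2\}$ be a prepacking of a set $P=P_1\cup P_2\subseteq V$ that satisfies the balance property $\mathcal{P}$. Then $\Pi_P$ is sufficiently balanced with respect to $k$: every bipartition $\{V_1,V_2\}$ of $V$ with $P_1\subseteq V_1$, $P_2\subseteq V_2$ and $\max(c(V_1),c(V_2))\le L_2$ is deeply balanced with respect to $k$.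
   Context: A weighted hypergraph $H=(V,E,c,\omega)$ has vertex set $V$, nets $E$ (subsets of $V$), vertex weights $c:V\to\mathbb{R}_{>0}$ and net weights $\omega:E\to\mathbb{R}_{>0}$; for $U\subseteq V$, $c(U):=\sum_{v\in U}c(v)$. A $k'$-way partition of a set is a partition into $k'$ non-empty pairwise disjoint blocks; for a partition $\Pi$, $\max(\Pi)$ denotes the maximum block weight. A prepacking of $V$ into two blocks is a 2-way partition $\{P_1,P_2\}$ of a subset $P\subseteq V$; vertices of $P$ are fixed, those of $V\setminus P$ ordinary. A subset $V'\subseteq V$ is deeply balanced with respect to $k'$ if there is a $k'$-way partition $\Pi'$ of $V'$ with $\max(\Pi')\le L_k$. A two-block partition $\{A_1,A_2\}$ (of $V$, or of $P$ in the case of a prepacking) is deeply balanced with respect to $k$ if $A_1$ is deeply balanced with respect to $\lceil k/2\rceil$ and $A_2$ with respect to $\lfloor k/2\rfloor$. For a sequence $S=\langle s_1,\ldots,s_m\rangle$ of vertices and integer $k''\ge1$, $h_{k''}(S):=\max_{1\le i\le m}\big(c(s_i)+\frac{1}{k''}\sum_{j=1}^{i-1}c(s_j)\big)$. The prepacking $\Pi_P=\{P_1,P_2\}$ satisfies the balance property $\mathcal{P}$ if, letting $O_t$ be the sequence of the $t$ heaviest vertices of $V\setminus P$ sorted in decreasing order of weight, where $t$ is the smallest number with $\max(c(P_1),c(P_2))+c(O_t)\ge L_2$, the following hold: (i) $\Pi_P$ is deeply balanced with respect to $k$; (ii) $\frac{1}{k/2}\max(c(P_1),c(P_2))+h_{k/2}(O_t)\le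 L_k$.
   Formalization: In the balance property t is required to be at least 1, since for t = 0 the maximum defining h(O_t) is over an empty set (and with value 0 the claim fails); if no such t exists, O_t is taken to be all ordinary vertices, with h = 0 when there are none. *)

theory Defs
  imports Complex_Main "HOL-Library.Disjoint_Sets"
begin

locale weighted_hypergraph =
  fixes V :: "'v set" and E :: "'v set set" and c :: "'v \<Rightarrow> real" and \<omega> :: "'v set \<Rightarrow> real"
  assumes finite_V: "finite V"
    and nets: "E \<subseteq> Pow V"
    and vertex_weight_pos: "\<And>v. v \<in> V \<Longrightarrow> c v > 0"
    and net_weight_pos: "\<And>e. e \<in> E \<Longrightarrow> \<omega> e > 0"

definition weight :: "('v \<Rightarrow> real) \<Rightarrow> 'v set \<Rightarrow> real" where
  "weight c U = (\<Sum>v\<in>U. c v)"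

definition kway_partition :: "nat \<Rightarrow> 'v set \<Rightarrow> 'v set set \<Rightarrow> bool" where
  "kway_partition k' A Q \<longleftrightarrow> partition_on A Q \<and> finite Q \<and> card Q = k'"

definition max_block_weight :: "('v \<Rightarrow> real) \<Rightarrow> 'v set set \<Rightarrow> real" where
  "max_block_weight c Q = Max (weight c ` Q)"

definition prepacking :: "'v set \<Rightarrow> 'v set \<Rightarrow> 'v set \<Rightarrow> bool" where
  "prepacking V P\<^sub>1 P\<^sub>2 \<longleftrightarrow> P\<^sub>1 \<union> P\<^sub>2 \<subseteq> V \<and> kway_partition 2 (P\<^sub>1 \<union> P\<^sub>2) {P\<^sub>1, P\<^sub>2}"

definition deeply_balanced_set :: "('v \<Rightarrow> real) \<Rightarrow> real \<Rightarrow> nat \<Rightarrow> 'v set \<Rightarrow> bool" where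
  "deeply_balanced_set c L\<^sub>k k' V' \<longleftrightarrow>
     (\<exists>Q'. kway_partition k' V' Q' \<and> max_block_weight c Q' \<le> L\<^sub>k)"

definition deeply_balanced :: "('v \<Rightarrow> real) \<Rightarrow> real \<Rightarrow> nat \<Rightarrow> 'v set \<Rightarrow> 'v set \<Rightarrow> bool" where
  "deeply_balanced c L\<^sub>k k A\<^sub>1 A\<^sub>2 \<longleftrightarrow>
     deeply_balanced_set c L\<^sub>k (nat \<lceil>real k / 2\<rceil>) A\<^sub>1 \<and>
     deeply_balanced_set c L\<^sub>k (nat \<lfloor>real k / 2\<rfloor>) A\<^sub>2"

definition sufficiently_balanced ::
  "'v set \<Rightarrow> ('v \<Rightarrow> real) \<Rightarrow> real \<Rightarrow> real \<Rightarrow> nat \<Rightarrow> 'v set \<Rightarrow> 'v set \<Rightarrow> bool" where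
  "sufficiently_balanced V c L\<^sub>2 L\<^sub>k k P\<^sub>1 P\<^sub>2 \<longleftrightarrow>
     (\<forall>V\<^sub>1 V\<^sub>2. kway_partition 2 V {V\<^sub>1, V\<^sub>2} \<and> P\<^sub>1 \<subseteq> V\<^sub>1 \<and> P\<^sub>2 \<subseteq> V\<^sub>2 \<and>
        max (weight c V\<^sub>1) (weight c V\<^sub>2) \<le> L\<^sub>2 \<longrightarrow> deeply_balanced c L\<^sub>k k V\<^sub>1 V\<^sub>2)"

text \<open>The list index is 0-based. The maximum ranges over a non-empty set unless \<open>S\<close> is empty, in
  which case the value is 0 by convention.\<close>

definition h :: "('v \<Rightarrow> real) \<Rightarrow> nat \<Rightarrow> 'v list \<Rightarrow> real" where
  "h c k'' S = (if S = [] then 0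
     else Max ((\<lambda>i. c (S ! i) + 1 / real k'' * (\<Sum>j<i. c (S ! j))) ` {..<length S}))"

definition decreasing_enumeration :: "('v \<Rightarrow> real) \<Rightarrow> 'v set \<Rightarrow> 'v list \<Rightarrow> bool" where
  "decreasing_enumeration c W xs \<longleftrightarrow>
     distinct xs \<and> set xs = W \<and> sorted_wrt (\<lambda>u v. c u \<ge> c v) xs"

text \<open>If \<open>xs\<close> is a decreasing enumeration of the ordinary vertices, then \<open>take t xs\<close> consists of the
  \<open>t\<close> heaviest ones. The number \<open>t\<close> is at least 1, because \<open>h\<close> is a maximum over a non-empty
  sequence. If even all ordinary vertices together do not lift \<open>m\<close> to the bound \<open>L\<^sub>2\<close> (or if there
  are none), no such \<open>t\<close> exists, and all ordinary vertices are taken.\<close>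

definition heaviest_count :: "('v \<Rightarrow> real) \<Rightarrow> real \<Rightarrow> real \<Rightarrow> 'v list \<Rightarrow> nat" where
  "heaviest_count c L\<^sub>2 m xs =
     (let reaches = (\<lambda>t. 1 \<le> t \<and> t \<le> length xs \<and> m + weight c (set (take t xs)) \<ge> L\<^sub>2)
      in if \<exists>t. reaches t then (LEAST t. reaches t) else length xs)"

text \<open>Vertices of equal weight make the enumeration \<open>xs\<close> non-unique, but the sequence of weights,
  and hence the truth of the condition, does not depend on its choice.\<close>

definition balance_property ::
  "'v set \<Rightarrow> ('v \<Rightarrow> real) \<Rightarrow> real \<Rightarrow> real \<Rightarrow> nat \<Rightarrow> 'v set \<Rightarrow> 'v set \<Rightarrow> bool" where
  "balance_property V c L\<^sub>2 L\<^sub>k k P\<^sub>1 P\<^sub>2 \<longleftrightarrow>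
     (\<exists>xs. decreasing_enumeration c (V - (P\<^sub>1 \<union> P\<^sub>2)) xs \<and>
        (let m = max (weight c P\<^sub>1) (weight c P\<^sub>2);
             O\<^sub>t = take (heaviest_count c L\<^sub>2 m xs) xs
         in deeply_balanced c L\<^sub>k k P\<^sub>1 P\<^sub>2 \<and>
            1 / (real k / 2) * m + h c (k div 2) O\<^sub>t \<le> L\<^sub>k))"

end

theory Submission
  imports Defs
begin

text \<open>Fix one side of a bipartition and distribute its ordinary vertices, heaviest first, each onto
  the currently lightest of the \<open>k/2\<close> blocks. The lightest block weighs at most the average, so
  placing \<open>x\<close> on top of total weight \<open>w\<close> yields a block of weight at most \<open>c x + w / (k/2)\<close>. If \<open>x\<close> is
  among the \<open>t\<close> heaviest ordinary vertices, this is one of the terms bounded by condition (ii).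
  Otherwise \<open>x\<close> is no heavier than the last vertex \<open>y\<close> of \<open>O\<^sub>t\<close>, and \<open>w + c x \<le> L\<^sub>2 \<le> m + c(O\<^sub>t)\<close>, so
  the bound is at most the term of (ii) belonging to \<open>y\<close>.\<close>

lemma lightest_block_le_average:
  assumes "kway_partition n A Q" and "n \<ge> 1" and "finite A"
  obtains B where "B \<in> Q" and "weight c B \<le> weight c A / real n"
proof -
  have Q: "partition_on A Q" "finite Q" "card Q = n"
    using assms(1) by (auto simp: kway_partition_def)
  have total: "weight c A = (\<Sum>B\<in>Q. weight c B)"
  proof -
    have "\<forall>B\<in>Q. finite B" "\<forall>B\<in>Q. \<forall>C\<in>Q. B \<noteq> C \<longrightarrow> B \<inter> C = {}"
      using Q(1) assms(3) by (auto simp: partition_on_def disjoint_def intro: finite_subset)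
    then have "sum c (\<Union>Q) = (\<Sum>B\<in>Q. sum c B)"
      by (simp add: sum.Union_disjoint)
    then show ?thesis
      using Q(1) by (simp add: weight_def partition_on_def)
  qed
  have "\<exists>B\<in>Q. weight c B \<le> weight c A / real n"
  proof (rule ccontr)
    assume "\<not> ?thesis"
    \<comment> \<open>As \<open>n\<close> is at least 1, \<open>Q\<close> is non-empty, so
      strictness survives the summation; the left side is \<open>n\<close> times the average, which
      is the weight of \<open>A\<close> itself.\<close>
    then have "(\<Sum>B\<in>Q. weight c A / real n) < (\<Sum>B\<in>Q. weight c B)"
      using Q assms(2) by (intro sum_strict_mono) auto
    then show False
      using total Q assms(2) by simp
  qed
  then show thesis using that by blast
qed

lemma deeply_balanced_set_insert:
  assumes "deeply_balanced_set c L n A" and "n \<ge> 1" and "finite A" and "x \<notin> A"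
    and bound: "c x + weight c A / real n \<le> L"
  shows "deeply_balanced_set c L n (insert x A)"
proof -
  obtain Q where kway: "kway_partition n A Q" and max: "max_block_weight c Q \<le> L"
    using assms(1) by (auto simp: deeply_balanced_set_def)
  then have Q: "partition_on A Q" "finite Q" "card Q = n"
    by (auto simp: kway_partition_def)
  obtain B where B: "B \<in> Q" "weight c B \<le> weight c A / real n"
    using lightest_block_le_average[OF kway assms(2,3)] .
  let ?Q = "insert (insert x B) (Q - {B})"
  have le: "weight c C \<le> L" if "C \<in> Q" for C
    using max that Q(2) by (auto simp: max_block_weight_def intro: order_trans[OF Max_ge])
  have "B \<subseteq> A" using B(1) Q(1) by (auto simp: partition_on_def)
  then have fresh: "x \<notin> B" "finite B" using assms(3,4) by (auto intro: finite_subset)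
  \<comment> \<open>Every block lies in \<open>A\<close>, which misses \<open>x\<close>. Hence the
    enlarged block does not coincide with an old one, and exchanging it for \<open>B\<close> keeps
    the number of blocks.\<close>
  have new: "insert x B \<notin> Q" using Q(1) assms(4) by (auto simp: partition_on_def)
  have "partition_on (insert x A) ?Q"
    using Q(1) B(1) assms(4) unfolding partition_on_def disjoint_def by blast
  moreover have "card ?Q = n"
    using Q B(1) new assms(2) by simp
  ultimately have "kway_partition n (insert x A) ?Q"
    using Q(2) by (simp add: kway_partition_def)
  moreover have "weight c (insert x B) \<le> L"
    using fresh B(2) bound by (simp add: weight_def)
  then have "max_block_weight c ?Q \<le> L"
    using le Q(2) by (auto simp: max_block_weight_def)
  ultimately show ?thesis
    by (auto simp: deeply_balanced_set_def)
qed

text \<open>Vertices outside \<open>W\<close> are skipped instead of being filtered out of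
  \<open>xs\<close>. Positions thus remain positions in the enumeration of the ordinary vertices of
  both sides, to which \<open>h\<close> and \<open>heaviest_count\<close> refer.\<close>

lemma deeply_balanced_set_greedy:
  assumes start: "deeply_balanced_set c L n A" and "n \<ge> 1" and "finite A" and "distinct xs"
    and disj: "A \<inter> set xs = {}"
    and bound: "\<And>i. \<lbrakk>i < length xs; xs ! i \<in> W\<rbrakk> \<Longrightarrow>
      c (xs ! i) + weight c (A \<union> (W \<inter> set (take i xs))) / real n \<le> L"
  shows "deeply_balanced_set c L n (A \<union> (W \<inter> set xs))"
proof -
  have "deeply_balanced_set c L n (A \<union> (W \<inter> set (take p xs)))" if "p \<le> length xs" for p
    using that
  proof (induction p)
    case 0
    then show ?case using start by simp
  next
    case (Suc p)
    then have p: "p < length xs" by simp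
    have IH: "deeply_balanced_set c L n (A \<union> (W \<inter> set (take p xs)))" using Suc by simp
    have step: "set (take (Suc p) xs) = insert (xs ! p) (set (take p xs))"
      using p by (simp add: take_Suc_conv_app_nth)
    show ?case
    proof (cases "xs ! p \<in> W")
      case False
      then show ?thesis using IH step by simp
    next
      case True
      have "xs ! p \<notin> set (take p xs)"
        using p assms(4) by (auto simp: in_set_conv_nth nth_eq_iff_index_eq)
      then have "xs ! p \<notin> A \<union> (W \<inter> set (take p xs))"
        using p disj by auto
      then have "deeply_balanced_set c L n (insert (xs ! p) (A \<union> (W \<inter> set (take p xs))))"
        using IH assms(2,3) bound[OF p True] by (intro deeply_balanced_set_insert) auto
      then show ?thesis using True step by simp
    qed
  qed
  from this[of "length xs"] show ?thesis by simp
qed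

lemma h_ge_nth:
  assumes "i < length S"
  shows "c (S ! i) + (\<Sum>j<i. c (S ! j)) / real n \<le> h c n S"
  using assms unfolding h_def by (auto intro!: Max_ge)

lemma weight_set_take:
  assumes "distinct xs" and "i \<le> length xs"
  shows "weight c (set (take i xs)) = (\<Sum>j<i. c (xs ! j))"
proof -
  have "weight c (set (take i xs)) = sum_list (map c (take i xs))"
    using assms(1) by (simp add: weight_def sum_list_distinct_conv_sum_set)
  also have "\<dots> = (\<Sum>j<i. c (xs ! j))"
    using assms(2) by (simp add: sum_list_sum_nth atLeast0LessThan)
  finally show ?thesis .
qed

text \<open>The fallback value is \<open>length xs\<close>, so a smaller count can only come from
  the \<open>LEAST\<close> branch, whose value satisfies the defining condition.\<close>

lemma heaviest_count_reaches:
  assumes "heaviest_count c L\<^sub>2 m xs < length xs"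
  shows "1 \<le> heaviest_count c L\<^sub>2 m xs"
    and "L\<^sub>2 \<le> m + weight c (set (take (heaviest_count c L\<^sub>2 m xs) xs))"
proof -
  let ?R = "\<lambda>t. 1 \<le> t \<and> t \<le> length xs \<and> m + weight c (set (take t xs)) \<ge> L\<^sub>2"
  have ex: "\<exists>t. ?R t" and eq: "heaviest_count c L\<^sub>2 m xs = (LEAST t. ?R t)"
    using assms by (auto simp: heaviest_count_def Let_def split: if_splits)
  from LeastI_ex[OF ex] show "1 \<le> heaviest_count c L\<^sub>2 m xs"
    and "L\<^sub>2 \<le> m + weight c (set (take (heaviest_count c L\<^sub>2 m xs) xs))"
    unfolding eq by blast+
qed

text \<open>Treats one side \<open>U\<close> with fixed part \<open>A\<close>, while
  \<open>W\<close> holds the ordinary vertices of both sides. Since \<open>m\<close> is only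
  required to bound the weight of \<open>A\<close>, taking it as the maximum over both fixed parts
  lets the same statement serve either side.\<close>

lemma deeply_balanced_set_extension:
  assumes base: "deeply_balanced_set c L n A" and n: "n \<ge> 1" and "finite U" and "A \<subseteq> U"
    and enum: "decreasing_enumeration c W xs" and "A \<inter> W = {}" and "U \<subseteq> A \<union> W"
    and pos: "\<And>v. v \<in> U \<union> W \<Longrightarrow> c v > 0"
    and U: "weight c U \<le> L\<^sub>2" and m: "weight c A \<le> m"
    and bound: "m / real n + h c n (take (heaviest_count c L\<^sub>2 m xs) xs) \<le> L"
  shows "deeply_balanced_set c L n U"
proof -
  define t where "t = heaviest_count c L\<^sub>2 m xs"
  have xs: "distinct xs" "set xs = W" "sorted_wrt (\<lambda>u v. c u \<ge> c v) xs"
    using enum by (auto simp: decreasing_enumeration_def)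
  have finA: "finite A" using assms(3,4) by (rule rev_finite_subset)
  \<comment> \<open>Condition (ii) read at a single position: the first \<open>t\<close> entries of
    \<open>xs\<close> form the argument of \<open>h\<close>, and the summand for \<open>m\<close> is
    merged into the average.\<close>
  have term_le: "c (xs ! i) + (m + (\<Sum>j<i. c (xs ! j))) / real n \<le> L"
    if "i < length xs" "i < t" for i
    using h_ge_nth[of i "take t xs" c n] that bound
    by (simp add: t_def[symmetric] add_divide_distrib)
  have "c (xs ! i) + weight c (A \<union> (U \<inter> set (take i xs))) / real n \<le> L"
    if i: "i < length xs" "xs ! i \<in> U" for i
  proof -
    let ?B = "U \<inter> set (take i xs)"
    have take_W: "set (take i xs) \<subseteq> W" using xs(2) by (auto dest: in_set_takeD)
    have split: "weight c (A \<union> ?B) = weight c A + weight c ?B"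
      using finA take_W assms(6) unfolding weight_def by (intro sum.union_disjoint) auto
    show ?thesis
    proof (cases "i < t")
      case True
      \<comment> \<open>The prefix may contain vertices of the other side. Weights are positive, so
        counting these as well only enlarges the sum and gives the term of \<open>h\<close> at
        \<open>i\<close>.\<close>
      have "weight c ?B \<le> weight c (set (take i xs))"
        unfolding weight_def using take_W pos by (intro sum_mono2) (auto intro: less_imp_le)
      then have "weight c (A \<union> ?B) \<le> m + (\<Sum>j<i. c (xs ! j))"
        using split m i(1) xs(1) by (simp add: weight_set_take)
      then have "weight c (A \<union> ?B) / real n \<le> (m + (\<Sum>j<i. c (xs ! j))) / real n"
        by (rule divide_right_mono) simp
      then show ?thesis using term_le[OF i(1) True] by simp
    next
      case False
      then have "t < length xs" using i(1) by simp
      then have t: "1 \<le> t" "L\<^sub>2 \<le> m + weight c (set (take t xs))"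
        using heaviest_count_reaches[of c L\<^sub>2 m xs] by (auto simp: t_def)
      \<comment> \<open>With 0-based indices this is the position of the last vertex of the first
        \<open>t\<close>; it exists because \<open>t\<close> is at least 1.\<close>
      define s where "s = t - 1"
      have s: "t = Suc s" "s < length xs" "s < i" using t(1) False \<open>t < length xs\<close> by (auto simp: s_def)
      have light: "c (xs ! i) \<le> c (xs ! s)"
        using xs(3) s(3) i(1) by (simp add: sorted_wrt_iff_nth_less)
      have reach: "L\<^sub>2 \<le> m + (\<Sum>j<s. c (xs ! j)) + c (xs ! s)"
        using t(2) s(1,2) xs(1) by (simp add: weight_set_take)
      have "xs ! i \<notin> set (take i xs)"
        using i(1) xs(1) by (auto simp: in_set_conv_nth nth_eq_iff_index_eq)
      moreover have "xs ! i \<notin> A" using i(1) xs(2) assms(6) by auto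
      ultimately have "c (xs ! i) + weight c (A \<union> ?B) = weight c (insert (xs ! i) (A \<union> ?B))"
        using finA by (simp add: weight_def)
      also have "\<dots> \<le> weight c U"
        unfolding weight_def using assms(3,4) i(2) pos
        by (intro sum_mono2) (auto intro: less_imp_le)
      finally have total: "c (xs ! i) + weight c (A \<union> ?B) \<le> L\<^sub>2" using U by simp
      have n1: "1 \<le> real n" using n by simp
      \<comment> \<open>Write \<open>w\<close> for the weight already placed. Then
        \<open>n * c (xs ! i) + w\<close> splits into \<open>(n - 1) * c (xs ! i)\<close>, handled
        by \<open>light\<close>, and \<open>c (xs ! i) + w\<close>, handled by \<open>total\<close>
        and \<open>reach\<close>. Monotonicity in the first part needs \<open>n\<close> to be at
        least 1.\<close>
      have "(real n - 1) * c (xs ! i) \<le> (real n - 1) * c (xs ! s)"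
        using light n1 by (intro mult_left_mono) auto
      then have "real n * c (xs ! i) + weight c (A \<union> ?B)
          \<le> real n * c (xs ! s) + (m + (\<Sum>j<s. c (xs ! j)))"
        using total reach by (simp add: algebra_simps)
      from divide_right_mono[OF this, of "real n"]
      have "c (xs ! i) + weight c (A \<union> ?B) / real n
          \<le> c (xs ! s) + (m + (\<Sum>j<s. c (xs ! j))) / real n"
        using n by (simp add: add_divide_distrib)
      also have "\<dots> \<le> L" using term_le[of s] s by simp
      finally show ?thesis .
    qed
  qed
  then have "deeply_balanced_set c L n (A \<union> (U \<inter> set xs))"
    using base n finA xs(1,2) assms(6) by (intro deeply_balanced_set_greedy) auto
  moreover have "A \<union> (U \<inter> set xs) = U" using xs(2) assms(4,7) by blast
  ultimately show ?thesis by simp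
qed

theorem theorem5:
  fixes V :: "'v set" and E :: "'v set set" and c :: "'v \<Rightarrow> real" and \<omega> :: "'v set \<Rightarrow> real"
    and k :: nat and \<epsilon> \<epsilon>' L\<^sub>k L\<^sub>2 :: real and P\<^sub>1 P\<^sub>2 :: "'v set"
  assumes "weighted_hypergraph V E c \<omega>"
    and "k \<ge> 2" and "even k" and "\<epsilon> \<ge> 0"
    and "L\<^sub>k = (1 + \<epsilon>) * real_of_int \<lceil>weight c V / real k\<rceil>"
    and "\<epsilon>' = ((1 + \<epsilon>) * (weight c V / real k) * (real k / weight c V))
                powr (1 / real_of_int \<lceil>log 2 (real k)\<rceil>) - 1"
    and "L\<^sub>2 = (1 + \<epsilon>') * real_of_int \<lceil>weight c V / 2\<rceil>"
    and "prepacking V P\<^sub>1 P\<^sub>2"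
    and "balance_property V c L\<^sub>2 L\<^sub>k k P\<^sub>1 P\<^sub>2"
  shows "sufficiently_balanced V c L\<^sub>2 L\<^sub>k k P\<^sub>1 P\<^sub>2"
proof -
  obtain n where k: "k = 2 * n" using assms(3) by (rule evenE)
  then have n: "n \<ge> 1" using assms(2) by simp
  have half: "real k / 2 = real n" using k by simp
  \<comment> \<open>As \<open>k\<close> is even, floor and ceiling of \<open>k/2\<close> are both
    \<open>n\<close>, which makes the two sides symmetric.\<close>
  have db: "deeply_balanced c L\<^sub>k k A\<^sub>1 A\<^sub>2 \<longleftrightarrow>
      deeply_balanced_set c L\<^sub>k n A\<^sub>1 \<and> deeply_balanced_set c L\<^sub>k n A\<^sub>2" for A\<^sub>1 A\<^sub>2
    unfolding deeply_balanced_def half by simp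
  define m where "m = max (weight c P\<^sub>1) (weight c P\<^sub>2)"
  obtain xs where xs: "decreasing_enumeration c (V - (P\<^sub>1 \<union> P\<^sub>2)) xs"
    and base: "deeply_balanced_set c L\<^sub>k n P\<^sub>1" "deeply_balanced_set c L\<^sub>k n P\<^sub>2"
    and bound: "m / real n + h c n (take (heaviest_count c L\<^sub>2 m xs) xs) \<le> L\<^sub>k"
    using assms(9) by (auto simp: balance_property_def Let_def m_def db[unfolded k] k)
  have V: "finite V" "\<And>v. v \<in> V \<Longrightarrow> c v > 0"
    using assms(1) by (auto simp: weighted_hypergraph_def)
  show ?thesis
    unfolding sufficiently_balanced_def db
  proof (intro allI impI, elim conjE)
    fix V\<^sub>1 V\<^sub>2
    assume part: "kway_partition 2 V {V\<^sub>1, V\<^sub>2}" and sub: "P\<^sub>1 \<subseteq> V\<^sub>1" "P\<^sub>2 \<subseteq> V\<^sub>2"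
      and le: "max (weight c V\<^sub>1) (weight c V\<^sub>2) \<le> L\<^sub>2"
    \<comment> \<open>If the two blocks were equal, the set of blocks would have cardinality 1
      instead of 2. Disjointness of a partition speaks only about distinct blocks.\<close>
    have "V\<^sub>1 \<noteq> V\<^sub>2" using part by (auto simp: kway_partition_def)
    then have "V\<^sub>1 \<union> V\<^sub>2 = V" "V\<^sub>1 \<inter> V\<^sub>2 = {}"
      using part by (auto simp: kway_partition_def partition_on_def disjoint_def)
    moreover from this have "finite V\<^sub>1" "finite V\<^sub>2" using V(1) by auto
    ultimately show "deeply_balanced_set c L\<^sub>k n V\<^sub>1 \<and> deeply_balanced_set c L\<^sub>k n V\<^sub>2"
      using sub le V(2) n
      by (intro conjI deeply_balanced_set_extension[OF base(1) _ _ _ xs _ _ _ _ _ bound]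
          deeply_balanced_set_extension[OF base(2) _ _ _ xs _ _ _ _ _ bound])
        (auto simp: m_def)
  qed
qed

end
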